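(* Let $\{(\mathbf{x}^k,\mathbf{y}^k)\}_{k\ge 0}\subset\mathbb{R}^N\times\mathbb{R}^N$ be a sequence generated, from an initial pair $(\mathbf{x}^0,\mathbf{y}^0)\in\mathbb{R}^N\times\mathbb{R}^N$, by the iteration $$\mathbf{x}^{k+1}\in\mathrm{prox}_{\beta\|\cdot\|_0}(\mathbf{y}^k),\qquad \mathbf{y}^{k+1}=\mathbf{x}^{k+1}-\frac{\beta}{\gamma}\mathbf{K}^*(\mathbf{K}\mathbf{y}^{k+1}-\mathbf{r}),\qquad k\ge 0.$$ If $\beta,\gamma>0$ are chosen such that $0<\frac{\beta}{\gamma}<\frac{\sqrt5-1}{2}$, then $\{(\mathbf{x}^k,\mathbf{y}^k)\}$ converges to a local minimizer $(\mathbf{x}^\star,\mathbf{y}^\star)$ of $F$ on $\mathbb{R}^N\times\mathbb{R}^N$. Moreover, the sequence $\{F(\mathbf{x}^k,\mathbf{y}^k)\}$ converges to $F(\mathbf{x}^\star,\mathbf{y}^\star)$. Furthermore, if $|y_j^\star|\ne\sqrt{2\beta}$ for all $j\in N(\mathbf{y}^\star)$, then $\mathbf{y}^\star$ is a local minimizer of $Q$ on $\mathbb{R}^N$.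
   Context: Let $d,M,N$ be positive integers with $d<M\le N$. $\mathbf{F}$ is the $M\times M$ discrete Fourier matrix $\mathbf{F}_{mn}=\frac{1}{\sqrt{M}}\exp\left(-i\frac{2\pi(m-1)(n-1)}{M}\right)$. $\mathbf{R}$ is a $d\times M$ row selector matrix: it consists of $d$ distinct rows of the $M\times M$ identity matrix, chosen so that for $2\le m\le M$, if the $m$-th row is included then so is the $(M-m+2)$-th row. $\mathbf{W}$ is an $N\times M$ tight framelet matrix, i.e. a real matrix with $\mathbf{W}^*\mathbf{W}=\mathbf{I}$. Put $\mathbf{K}:=\mathbf{R}\mathbf{F}\mathbf{W}^*$ (a complex $d\times N$ matrix; $*$ is conjugate transpose). The vector $\mathbf{r}\in\mathbb{R}^d$ is fixed, and $\|\cdot\|_2$ is the Euclidean norm (on $\mathbb{R}^N$ or $\mathbb{C}^d$). $\|\mathbf{x}\|_0$ is the number of nonzero components of $\mathbf{x}\in\mathbb{R}^N$, and $N(\mathbf{x}):=\{i:x_i\neq0\}$ is its support. For $\mathbf{x},\mathbf{y}\in\mathbb{R}^N$, $$F(\mathbf{x},\mathbf{y}):=\tfrac12\|\mathbf{K}\mathbf{y}-\mathbf{r}\|_2^2+\tfrac{\gamma}{2\beta}\|\mathbf{x}-\mathbf{y}\|_2^2+\gamma\|\mathbf{x}\|_0,\qquad Q(\mathbf{y}):=\tfrac12\|\mathbf{K}\mathbf{y}-\mathbf{r}\|_2^2+\gamma\,\mathrm{env}_{\beta\|\cdot\|_0}(\mathbf{y}),$$ where $\mathrm{env}_{\beta\|\cdot\|_0}(\mathbf{y}):=\min\{\frac{1}{2\beta}\|\mathbf{y}-\mathbf{z}\|_2^2+\|\mathbf{z}\|_0:\mathbf{z}\in\mathbb{R}^N\}$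 is the Moreau envelope. $\mathrm{prox}_{\beta\|\cdot\|_0}(\mathbf{z})$ is the (nonempty) set of minimizers of $\mathbf{x}\mapsto\frac{1}{2\beta}\|\mathbf{x}-\mathbf{z}\|_2^2+\|\mathbf{x}\|_0$ over $\mathbf{x}\in\mathbb{R}^N$. $(\mathbf{x}^\star,\mathbf{y}^\star)$ is a local minimizer of $F$ if there is $\delta>0$ such that $F(\mathbf{x}^\star,\mathbf{y}^\star)\le F(\mathbf{x}^\star+\Delta\mathbf{x},\mathbf{y}^\star+\Delta\mathbf{y})$ for all $\|\Delta\mathbf{x}\|\le\delta$, $\|\Delta\mathbf{y}\|\le\delta$; local minimizers of $Q$ are defined in the same way. *)

theory Defs
  imports "HOL-Analysis.Analysis"
begin

text \<open>
  The dimensions d, M, N are the cardinalities of the finite index types \<open>'d\<close>, \<open>'m\<close>, \<open>'n\<close>.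
  Only the index type of size M needs its numbering 1, ..., M, because the Fourier matrix and the
  symmetry of the row selector refer to it; the numbering is an explicit parameter \<open>lbl\<close>.
\<close>

definition numbering :: "('m::finite \<Rightarrow> nat) \<Rightarrow> bool" where
  "numbering lbl \<longleftrightarrow> bij_betw lbl UNIV {1..CARD('m)}"

text \<open>
  Real vectors are embedded into complex ones wherever the complex matrix K acts. An update rule
  equating such embedded vectors is an equation over the complex numbers, so it also requires the
  imaginary part of its right-hand side to vanish.
\<close>

definition complex_vec :: "real ^ 'n \<Rightarrow> complex ^ 'n" where
  "complex_vec v = (\<chi> i. complex_of_real (v $ i))"

definition conj_transpose :: "complex ^ 'n ^ 'm \<Rightarrow> complex ^ 'm ^ 'n" where
  "conj_transpose A = (\<chi> i j. cnj (A $ j $ i))"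

definition fourier_matrix :: "('m::finite \<Rightarrow> nat) \<Rightarrow> complex ^ 'm ^ 'm" where
  "fourier_matrix lbl = (\<chi> m n. complex_of_real (1 / sqrt (real CARD('m))) *
     exp (- \<i> * complex_of_real
       (2 * pi * (real (lbl m) - 1) * (real (lbl n) - 1) / real CARD('m))))"

definition row_selector :: "('m::finite \<Rightarrow> nat) \<Rightarrow> complex ^ 'm ^ 'd \<Rightarrow> bool" where
  "row_selector lbl R \<longleftrightarrow>
     (\<exists>\<sigma> :: 'd \<Rightarrow> 'm. inj \<sigma> \<and> (\<forall>i. row i R = row (\<sigma> i) (mat 1)) \<and>
        (\<forall>m \<in> range \<sigma>. 2 \<le> lbl m \<longrightarrow> (\<exists>m' \<in> range \<sigma>. lbl m' = CARD('m) - lbl m + 2)))"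

definition tight_framelet :: "real ^ 'm ^ 'n \<Rightarrow> bool" where
  "tight_framelet W \<longleftrightarrow> transpose W ** W = mat 1"

definition supp :: "real ^ 'n \<Rightarrow> 'n set" where
  "supp x = {i. x $ i \<noteq> 0}"

definition l0_norm :: "real ^ 'n \<Rightarrow> nat" where
  "l0_norm x = card (supp x)"

definition prox_objective :: "real \<Rightarrow> real ^ 'n \<Rightarrow> real ^ 'n \<Rightarrow> real" where
  "prox_objective \<beta> z x = 1 / (2 * \<beta>) * (norm (x - z))\<^sup>2 + real (l0_norm x)"

definition prox_l0 :: "real \<Rightarrow> real ^ 'n \<Rightarrow> (real ^ 'n) set" where
  "prox_l0 \<beta> z = {x. \<forall>u. prox_objective \<beta> z x \<le> prox_objective \<beta> z u}"

text \<open>The infimum below is attained for positive \<open>\<beta>\<close>; see \<open>env_l0_attained\<close>.\<close>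

definition env_l0 :: "real \<Rightarrow> real ^ 'n \<Rightarrow> real" where
  "env_l0 \<beta> y = (INF z. 1 / (2 * \<beta>) * (norm (y - z))\<^sup>2 + real (l0_norm z))"

definition objective_F ::
  "complex ^ 'n ^ 'd \<Rightarrow> real ^ 'd \<Rightarrow> real \<Rightarrow> real \<Rightarrow> real ^ 'n \<Rightarrow> real ^ 'n \<Rightarrow> real" where
  "objective_F K r \<beta> \<gamma> x y =
     1 / 2 * (norm (K *v complex_vec y - complex_vec r))\<^sup>2
     + \<gamma> / (2 * \<beta>) * (norm (x - y))\<^sup>2 + \<gamma> * real (l0_norm x)"

definition objective_Q ::
  "complex ^ 'n ^ 'd \<Rightarrow> real ^ 'd \<Rightarrow> real \<Rightarrow> real \<Rightarrow> real ^ 'n \<Rightarrow> real" where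
  "objective_Q K r \<beta> \<gamma> y =
     1 / 2 * (norm (K *v complex_vec y - complex_vec r))\<^sup>2 + \<gamma> * env_l0 \<beta> y"

definition local_minimizer :: "('a::real_normed_vector \<Rightarrow> real) \<Rightarrow> 'a \<Rightarrow> bool" where
  "local_minimizer f x \<longleftrightarrow> (\<exists>\<delta>>0. \<forall>\<Delta>x. norm \<Delta>x \<le> \<delta> \<longrightarrow> f x \<le> f (x + \<Delta>x))"

definition local_minimizer2 ::
  "('a::real_normed_vector \<Rightarrow> 'b::real_normed_vector \<Rightarrow> real) \<Rightarrow> 'a \<Rightarrow> 'b \<Rightarrow> bool" where
  "local_minimizer2 f x y \<longleftrightarrow>
     (\<exists>\<delta>>0. \<forall>\<Delta>x \<Delta>y. norm \<Delta>x \<le> \<delta> \<longrightarrow> norm \<Delta>y \<le> \<delta> \<longrightarrow> f x y \<le> f (x + \<Delta>x) (y + \<Delta>y))"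

lemma prox_objective_sum:
  "prox_objective \<beta> z x =
     (\<Sum>i\<in>UNIV. 1 / (2 * \<beta>) * (x $ i - z $ i)\<^sup>2 + (if x $ i \<noteq> 0 then 1 else 0))"
proof -
  have "(norm (x - z))\<^sup>2 = (\<Sum>i\<in>UNIV. (x $ i - z $ i)\<^sup>2)"
    by (simp add: norm_vec_def L2_set_def sum_nonneg)
  moreover have "real (l0_norm x) = (\<Sum>i\<in>UNIV. if x $ i \<noteq> 0 then 1 else 0)"
    by (simp add: l0_norm_def supp_def sum.If_cases)
  ultimately show ?thesis
    by (simp add: prox_objective_def sum.distrib sum_distrib_left)
qed

lemma prox_l0_nonempty:
  fixes z :: "real ^ 'n"
  assumes "\<beta> > 0"
  shows "prox_l0 \<beta> z \<noteq> {}"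
proof -
  define x :: "real ^ 'n" where
    "x = (\<chi> i. if 1 / (2 * \<beta>) * (z $ i)\<^sup>2 \<le> 1 then 0 else z $ i)"
  have "prox_objective \<beta> z x \<le> prox_objective \<beta> z u" for u
    unfolding prox_objective_sum
  proof (rule sum_mono)
    fix i
    have "0 \<le> 1 / (2 * \<beta>) * (u $ i - z $ i)\<^sup>2"
      using assms by simp
    then show "1 / (2 * \<beta>) * (x $ i - z $ i)\<^sup>2 + (if x $ i \<noteq> 0 then 1 else 0)
        \<le> 1 / (2 * \<beta>) * (u $ i - z $ i)\<^sup>2 + (if u $ i \<noteq> 0 then 1 else 0)"
      by (cases "u $ i = 0") (auto simp: x_def)
  qed
  then show ?thesis
    by (auto simp: prox_l0_def)
qed

lemma env_l0_attained:
  fixes y :: "real ^ 'n"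
  assumes "\<beta> > 0"
  shows "\<exists>z. env_l0 \<beta> y = 1 / (2 * \<beta>) * (norm (y - z))\<^sup>2 + real (l0_norm z)
    \<and> (\<forall>u. env_l0 \<beta> y \<le> 1 / (2 * \<beta>) * (norm (y - u))\<^sup>2 + real (l0_norm u))"
proof -
  obtain z where z: "\<And>u. prox_objective \<beta> y z \<le> prox_objective \<beta> y u"
    using prox_l0_nonempty[OF assms, of y] by (auto simp: prox_l0_def)
  have "env_l0 \<beta> y = (INF u. prox_objective \<beta> y u)"
    by (simp add: env_l0_def prox_objective_def norm_minus_commute)
  also have "\<dots> = prox_objective \<beta> y z"
    by (rule cInf_eq_minimum) (auto simp: z)
  finally have "env_l0 \<beta> y = prox_objective \<beta> y z" .
  then show ?thesis
    using z by (intro exI[of _ z]) (auto simp: prox_objective_def norm_minus_commute)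
qed

end

theory Submission
  imports Defs
begin

text \<open>
  Only real linearity of \<open>A y = K y\<close> matters. Both half steps are exact minimizations of \<open>F\<close>, the
  one in \<open>y\<close> strongly convex, so \<open>F\<close> decreases by at least a multiple of the squared
  \<open>y\<close>-increment. Hence the increments of \<open>y\<close>, and with them those of \<open>x\<close>, tend to zero. A nonzero
  entry of a point in \<open>prox\<close> has modulus at least \<open>sqrt (2 * \<beta>)\<close>, so the support of \<open>x\<close> is
  eventually a constant set \<open>S\<close>. From then on \<open>x\<close> is the projection of \<open>y\<close> onto the coordinates in
  \<open>S\<close> and the iteration is an affine, Fejer monotone one, which converges. Near the limit,
  enlarging the support costs at least \<open>\<gamma>\<close>, while keeping it leaves a convex problem for which
  the limit is stationary. If no entry of the limit of \<open>y\<close> sits at the threshold, then \<open>prox\<close> is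
  the projection in a neighbourhood of it, and minimality passes from \<open>F\<close> to \<open>Q\<close>.
\<close>

section \<open>The smooth part of the objective\<close>

text \<open>\<open>A\<close> stands for \<open>K\<close> acting on embedded real vectors; keeping it
  abstract lets real unknowns and complex residuals share one Euclidean argument.\<close>

definition smooth_part ::
  "('a::real_inner \<Rightarrow> 'b::real_inner) \<Rightarrow> 'b \<Rightarrow> real \<Rightarrow> real \<Rightarrow> 'a \<Rightarrow> 'a \<Rightarrow> real" where
  "smooth_part A a \<beta> \<gamma> x y =
     1 / 2 * (norm (A y - a))\<^sup>2 + \<gamma> / (2 * \<beta>) * (norm (x - y))\<^sup>2"

text \<open>First-order condition for minimizing \<open>smooth_part\<close> in \<open>y\<close>, scaled by \<open>c = \<beta> / \<gamma>\<close>.\<close>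

definition stationary ::
  "('a::real_inner \<Rightarrow> 'b::real_inner) \<Rightarrow> 'b \<Rightarrow> real \<Rightarrow> 'a \<Rightarrow> 'a \<Rightarrow> bool" where
  "stationary A a c x y \<longleftrightarrow> (\<forall>v. inner (y - x) v + c * inner (A y - a) (A v) = 0)"

lemma power2_norm_add:
  fixes p q :: "'a::real_inner"
  shows "(norm (p + q))\<^sup>2 = (norm p)\<^sup>2 + 2 * inner p q + (norm q)\<^sup>2"
  by (simp add: dot_norm field_simps)

text \<open>Expanding the quadratic, stationarity cancels the terms linear in \<open>v\<close>, and
  only the nonnegative \<open>(norm (A v))\<^sup>2 / 2\<close> is dropped. The case
  \<open>u = 0\<close> yields the descent of the iteration, general \<open>u\<close> yields local
  minimality.\<close>

lemma smooth_part_ge: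
  assumes A: "linear A" and "\<beta> > 0" "\<gamma> > 0" and st: "stationary A a (\<beta> / \<gamma>) x y"
  shows "smooth_part A a \<beta> \<gamma> (x + u) (y + v)
    \<ge> smooth_part A a \<beta> \<gamma> x y + \<gamma> / \<beta> * inner (x - y) u + \<gamma> / (2 * \<beta>) * (norm (u - v))\<^sup>2"
proof -
  define t where "t = \<gamma> / \<beta>"
  have "inner (x - y) v = \<beta> / \<gamma> * inner (A y - a) (A v)"
    using st inner_minus_left[of "x - y" v] unfolding stationary_def by (smt (verit) minus_diff_eq)
  then have eq: "inner (A y - a) (A v) = t * inner (x - y) v"
    using assms(2,3) by (simp add: t_def)
  have "(norm (A (y + v) - a))\<^sup>2 = (norm ((A y - a) + A v))\<^sup>2"
    by (simp add: linear_add[OF A] algebra_simps)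
  also have "\<dots> = (norm (A y - a))\<^sup>2 + 2 * inner (A y - a) (A v) + (norm (A v))\<^sup>2"
    by (rule power2_norm_add)
  finally have 1: "(norm (A (y + v) - a))\<^sup>2 \<ge> (norm (A y - a))\<^sup>2 + 2 * inner (A y - a) (A v)"
    by simp
  have "(norm ((x + u) - (y + v)))\<^sup>2 = (norm ((x - y) + (u - v)))\<^sup>2"
    by (simp add: algebra_simps)
  also have "\<dots> = (norm (x - y))\<^sup>2 + 2 * (inner (x - y) u - inner (x - y) v) + (norm (u - v))\<^sup>2"
    unfolding power2_norm_add inner_diff_right[of _ u v] by simp
  finally have expand: "(norm ((x + u) - (y + v)))\<^sup>2 = (norm (x - y))\<^sup>2
      + 2 * (inner (x - y) u - inner (x - y) v) + (norm (u - v))\<^sup>2" .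
  have 2: "t / 2 * (norm ((x + u) - (y + v)))\<^sup>2 = t / 2 * (norm (x - y))\<^sup>2
      + t * inner (x - y) u - t * inner (x - y) v + t / 2 * (norm (u - v))\<^sup>2"
    unfolding expand by (simp add: field_simps)
  have t: "\<gamma> / (2 * \<beta>) = t / 2" by (simp add: t_def)
  show ?thesis
    using 1 2 eq unfolding smooth_part_def t t_def[symmetric] by argo
qed

lemma tendsto_smooth_part:
  fixes A :: "'a::euclidean_space \<Rightarrow> 'b::real_inner"
  assumes A: "linear A" and "(f \<longlongrightarrow> x) G" "(g \<longlongrightarrow> y) G"
  shows "((\<lambda>k. smooth_part A a \<beta> \<gamma> (f k) (g k)) \<longlongrightarrow> smooth_part A a \<beta> \<gamma> x y) G"
proof -
  have "bounded_linear A" using A by (rule linear_conv_bounded_linear[THEN iffD1])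
  then show ?thesis
    unfolding smooth_part_def
    by (intro tendsto_intros assms bounded_linear.tendsto[of A])
qed

section \<open>Proximity operator and coordinate projections\<close>

text \<open>Orthogonal projection onto the vectors supported in \<open>S\<close>.\<close>

definition restrict_to :: "'n set \<Rightarrow> real ^ 'n \<Rightarrow> real ^ 'n" where
  "restrict_to S y = (\<chi> i. if i \<in> S then y $ i else 0)"

lemma restrict_to_nth [simp]: "restrict_to S y $ i = (if i \<in> S then y $ i else 0)"
  by (simp add: restrict_to_def)

lemma linear_restrict_to: "linear (restrict_to S)"
  by (rule linearI) (auto simp: vec_eq_iff)

lemma restrict_to_idem: "restrict_to S (restrict_to S y) = restrict_to S y"
  by (simp add: vec_eq_iff)

lemma inner_restrict_to: "inner (restrict_to S y) z = inner y (restrict_to S z)"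
  unfolding inner_vec_def by (rule sum.cong) auto

lemma norm_restrict_to_le: "norm (restrict_to S y) \<le> norm y"
  unfolding norm_vec_def by (rule L2_set_mono) auto

text \<open>Changing a single coordinate reduces minimality to a scalar problem; testing it with
  \<open>0\<close> and \<open>z $ i\<close> gives hard thresholding. The inequalities are weak
  because at the threshold either value is optimal.\<close>

lemma prox_l0_nth:
  fixes x z :: "real ^ 'n"
  assumes "\<beta> > 0" and x: "x \<in> prox_l0 \<beta> z"
  shows "if x $ i \<noteq> 0 then x $ i = z $ i \<and> sqrt (2 * \<beta>) \<le> \<bar>z $ i\<bar> else \<bar>z $ i\<bar> \<le> sqrt (2 * \<beta>)"
proof -
  define h where "h s t = 1 / (2 * \<beta>) * (s - t)\<^sup>2 + (if s \<noteq> 0 then 1 else 0)" for s t :: real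
  have le: "h (x $ i) (z $ i) \<le> h s (z $ i)" for s
  proof -
    define u where "u = (\<chi> j. if j = i then s else x $ j)"
    have "(\<Sum>j\<in>UNIV. h (x $ j) (z $ j)) \<le> (\<Sum>j\<in>UNIV. h (u $ j) (z $ j))"
      using x by (simp add: prox_l0_def prox_objective_sum h_def)
    moreover have "(\<Sum>j\<in>UNIV - {i}. h (x $ j) (z $ j)) = (\<Sum>j\<in>UNIV - {i}. h (u $ j) (z $ j))"
      by (rule sum.cong) (auto simp: u_def)
    moreover have sum_split: "sum f UNIV = f i + sum f (UNIV - {i})" for f :: "'n \<Rightarrow> real"
      by (rule sum.remove) auto
    ultimately have "h (x $ i) (z $ i) \<le> h (u $ i) (z $ i)"
      using sum_split[of "\<lambda>j. h (x $ j) (z $ j)"] sum_split[of "\<lambda>j. h (u $ j) (z $ j)"]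
      by linarith
    then show ?thesis
      by (simp add: u_def)
  qed
  show ?thesis
  proof (cases "x $ i = 0")
    case True
    have "(z $ i)\<^sup>2 / (2 * \<beta>) \<le> 1"
      using le[of "z $ i"] True by (simp add: h_def split: if_splits)
    then have "(z $ i)\<^sup>2 \<le> 2 * \<beta>"
      using \<open>\<beta> > 0\<close> by (simp add: field_simps)
    then show ?thesis
      using True by (simp add: real_le_rsqrt)
  next
    case False
    have "1 / (2 * \<beta>) * (x $ i - z $ i)\<^sup>2 \<le> 0"
      using le[of "z $ i"] False by (simp add: h_def split: if_splits)
    then have eq: "x $ i = z $ i"
      using \<open>\<beta> > 0\<close> by (simp add: divide_le_0_iff)
    have "(z $ i)\<^sup>2 / (2 * \<beta>) \<ge> 1"
      using le[of 0] False eq by (simp add: h_def)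
    then have "2 * \<beta> \<le> (z $ i)\<^sup>2"
      using \<open>\<beta> > 0\<close> by (simp add: field_simps)
    then show ?thesis
      using False eq real_sqrt_le_mono by fastforce
  qed
qed

lemma prox_l0_eq_restrict_to:
  assumes "\<beta> > 0" "x \<in> prox_l0 \<beta> z"
  shows "x = restrict_to (supp x) z"
  using prox_l0_nth[OF assms] by (fastforce simp: vec_eq_iff supp_def split: if_splits)

text \<open>Because of this gap, two prox points closer than \<open>sqrt (2 * \<beta>)\<close> have
  the same support, even for different arguments.\<close>

lemma prox_l0_nth_ge:
  assumes "\<beta> > 0" "x \<in> prox_l0 \<beta> z" "i \<in> supp x"
  shows "sqrt (2 * \<beta>) \<le> \<bar>x $ i\<bar>"
  using prox_l0_nth[OF assms(1,2), of i] assms(3) by (simp add: supp_def)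

lemma env_l0_eq_prox:
  assumes "\<beta> > 0"
  obtains z where "z \<in> prox_l0 \<beta> y" "env_l0 \<beta> y = prox_objective \<beta> y z"
proof -
  obtain z where z: "env_l0 \<beta> y = prox_objective \<beta> y z" "\<And>u. env_l0 \<beta> y \<le> prox_objective \<beta> y u"
    using env_l0_attained[OF assms, of y] unfolding prox_objective_def norm_minus_commute[of y]
    by blast
  then have "z \<in> prox_l0 \<beta> y"
    by (simp add: prox_l0_def)
  then show thesis
    using z(1) by (rule that)
qed

section \<open>The iteration with a fixed projection\<close>

text \<open>The range of \<open>B\<close> is a closed subspace, so it contains a point nearest to
  \<open>s\<close>, whether or not \<open>B\<close> is injective.\<close>

lemma normal_equation_solvable:
  fixes B :: "'a::euclidean_space \<Rightarrow> 'b::euclidean_space"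
  assumes B: "linear B"
  obtains z where "\<And>v. inner (B z - s) (B v) = 0"
proof -
  have cl: "closed (range B)" and cv: "convex (range B)"
    using linear_subspace_image[OF B subspace_UNIV] by (auto intro: closed_subspace subspace_imp_convex)
  obtain z where z: "closest_point (range B) s = B z"
    using closest_point_in_set[OF cl, of s] by auto
  have "inner (s - B z) (B w - B z) \<le> 0" for w
    using closest_point_dot[OF cv cl, of "B w" s] z by simp
  \<comment> \<open>Moving from \<open>z\<close> by \<open>v\<close> and by \<open>- v\<close> turns
    the variational inequality into an equality.\<close>
  from this[of "z + _"] this[of "z - _"] have "inner (B z - s) (B v) = 0" for v
    by (simp add: linear_add[OF B] linear_diff[OF B] inner_diff_left order_antisym)
  then show thesis by (rule that)
qed

text \<open>Subtracting the two conditions, tested with \<open>y' - z\<close>, leaves a nonnegative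
  \<open>A\<close> term; Cauchy-Schwarz and nonexpansiveness of \<open>P\<close> finish.\<close>

lemma fejer_step:
  assumes A: "linear A" and P: "linear P" and "c > 0"
    and Ple: "\<And>v. norm (P v) \<le> norm v"
    and "stationary A a c (P y) y'" and "stationary A a c (P z) z"
  shows "norm (y' - z) \<le> norm (y - z)"
proof -
  have "inner (y' - P y) (y' - z) + c * inner (A y' - a) (A (y' - z)) = 0"
    and "inner (z - P z) (y' - z) + c * inner (A z - a) (A (y' - z)) = 0"
    using assms(5,6) by (auto simp: stationary_def)
  then have "inner (y' - z) (y' - z) - inner (P (y - z)) (y' - z)
      + c * inner (A (y' - z)) (A (y' - z)) = 0"
    by (simp add: linear_diff[OF A] linear_diff[OF P] inner_diff_left algebra_simps)
  moreover have "c * inner (A (y' - z)) (A (y' - z)) \<ge> 0"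
    using \<open>c > 0\<close> by simp
  ultimately have "(norm (y' - z))\<^sup>2 \<le> inner (P (y - z)) (y' - z)"
    unfolding power2_norm_eq_inner by linarith
  also have "\<dots> \<le> norm (y - z) * norm (y' - z)"
    by (meson Ple mult_right_mono norm_cauchy_schwarz norm_ge_zero order_trans)
  finally show ?thesis
    by (cases "y' = z") (auto simp: power2_eq_square)
qed

text \<open>A fixed point keeps the iterates bounded, vanishing increments make a cluster point
  fixed, and the monotone distance to that cluster point forces the whole sequence to it.\<close>

lemma projected_iteration_converges:
  fixes A :: "'a::euclidean_space \<Rightarrow> 'b::euclidean_space"
  assumes A: "linear A" and P: "linear P" and "c > 0"
    and Ple: "\<And>v. norm (P v) \<le> norm v"
    and idem: "\<And>v. P (P v) = P v" and adj: "\<And>v w. inner (P v) w = inner v (P w)"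
    and step: "\<And>k. stationary A a c (P (y k)) (y (Suc k))"
    and diff: "(\<lambda>k. y (Suc k) - y k) \<longlonglongrightarrow> 0"
  obtains z where "y \<longlonglongrightarrow> z" "stationary A a c (P z) z"
proof -
  have blA: "bounded_linear A" and blP: "bounded_linear P"
    using A P by (simp_all add: linear_conv_bounded_linear)
  \<comment> \<open>Fixed points are exactly the least-squares solutions of \<open>B w = (0, sqrt c *\<^sub>R a)\<close>, which
    exist although the problem need not be coercive.\<close>
  define B where "B v = (v - P v, sqrt c *\<^sub>R A v)" for v
  have "linear B"
    by (rule linearI) (simp_all add: B_def linear_add[OF A] linear_add[OF P] linear_scale[OF A]
        linear_scale[OF P] algebra_simps)
  then obtain w where w: "\<And>v. inner (B w - (0, sqrt c *\<^sub>R a)) (B v) = 0"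
    using normal_equation_solvable by blast
  have "stationary A a c (P w) w"
    unfolding stationary_def
  proof
    fix v
    \<comment> \<open>The residual of an orthogonal projection is orthogonal to its range, so the
      \<open>P v\<close> inside \<open>B v\<close> drops out of the normal equation.\<close>
    have "inner (w - P w) (P v) = 0"
      by (simp add: inner_diff_left adj idem)
    then show "inner (w - P w) v + c * inner (A w - a) (A v) = 0"
      using w[of v] \<open>c > 0\<close>
      by (simp add: B_def inner_diff_right scaleR_diff_right[symmetric] mult.assoc[symmetric])
  qed
  then have "norm (y (Suc k) - w) \<le> norm (y k - w)" for k
    by (rule fejer_step[OF A P \<open>c > 0\<close> Ple step])
  then have "decseq (\<lambda>k. norm (y k - w))"
    by (rule decseq_SucI)
  then have "y k \<in> cball w (norm (y 0 - w))" for k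
    using decseqD[of "\<lambda>k. norm (y k - w)" 0 k] by (simp add: dist_norm norm_minus_commute)
  then obtain z s where s: "strict_mono s" "(y \<circ> s) \<longlonglongrightarrow> z"
    using compact_cball[of w "norm (y 0 - w)"] unfolding compact_def by metis
  have lim: "(\<lambda>k. y (s k)) \<longlonglongrightarrow> z"
    using s(2) by (simp add: o_def)
  have "(\<lambda>k. (y (Suc (s k)) - y (s k)) + y (s k)) \<longlonglongrightarrow> 0 + z"
    by (intro tendsto_add lim) (use LIMSEQ_subseq_LIMSEQ[OF diff s(1)] in \<open>simp add: o_def\<close>)
  then have lim': "(\<lambda>k. y (Suc (s k))) \<longlonglongrightarrow> z"
    by simp
  have st: "stationary A a c (P z) z"
    unfolding stationary_def
  proof
    fix v
    have "(\<lambda>k. inner (y (Suc (s k)) - P (y (s k))) v + c * inner (A (y (Suc (s k))) - a) (A v))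
        \<longlonglongrightarrow> inner (z - P z) v + c * inner (A z - a) (A v)"
      by (intro tendsto_intros lim lim' bounded_linear.tendsto[OF blA] bounded_linear.tendsto[OF blP])
    then show "inner (z - P z) v + c * inner (A z - a) (A v) = 0"
      using step by (simp add: stationary_def LIMSEQ_const_iff)
  qed
  have "decseq (\<lambda>k. norm (y k - z))"
    by (intro decseq_SucI fejer_step[OF A P \<open>c > 0\<close> Ple step st])
  then obtain l where l: "(\<lambda>k. norm (y k - z)) \<longlonglongrightarrow> l"
    using decseq_convergent[of "\<lambda>k. norm (y k - z)" 0] by auto
  then have "(\<lambda>k. norm (y (s k) - z)) \<longlonglongrightarrow> l"
    using LIMSEQ_subseq_LIMSEQ[OF l s(1)] by (simp add: o_def)
  moreover have "(\<lambda>k. norm (y (s k) - z)) \<longlonglongrightarrow> 0"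
    using lim by (simp add: LIM_zero tendsto_norm_zero)
  ultimately have "l = 0"
    by (rule LIMSEQ_unique)
  with l have "y \<longlonglongrightarrow> z"
    by (simp add: LIM_zero_cancel tendsto_norm_zero_iff)
  then show thesis
    using st by (rule that)
qed

section \<open>Convergence of the alternating scheme\<close>

definition l0_objective ::
  "(real ^ 'n \<Rightarrow> 'b::real_inner) \<Rightarrow> 'b \<Rightarrow> real \<Rightarrow> real \<Rightarrow> real ^ 'n \<Rightarrow> real ^ 'n \<Rightarrow> real" where
  "l0_objective A a \<beta> \<gamma> x y = smooth_part A a \<beta> \<gamma> x y + \<gamma> * real (l0_norm x)"

text \<open>Hence the \<open>x\<close> half step minimizes F exactly, and minimizing F over
  \<open>x\<close> gives Q.\<close>

lemma l0_objective_prox: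
  "\<gamma> > 0 \<Longrightarrow> l0_objective A a \<beta> \<gamma> x y = 1 / 2 * (norm (A y - a))\<^sup>2 + \<gamma> * prox_objective \<beta> y x"
  by (simp add: l0_objective_def smooth_part_def prox_objective_def algebra_simps)

lemma local_minimizer2_l0_objective:
  assumes A: "linear A" and pos: "\<beta> > 0" "\<gamma> > 0"
    and st: "stationary A a (\<beta> / \<gamma>) x y" and x: "x = restrict_to (supp x) y"
  shows "local_minimizer2 (l0_objective A a \<beta> \<gamma>) x y"
proof -
  \<comment> \<open>\<open>M\<close> bounds the slope in \<open>u\<close> of the estimate
    \<open>smooth_part_ge\<close>; \<open>M + 1\<close> keeps the later quotient positive when
    \<open>M = 0\<close>.\<close>
  define M where "M = \<gamma> / \<beta> * norm (x - y)"
  have "M \<ge> 0" using pos by (simp add: M_def)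
  have "\<forall>i\<in>supp x. \<forall>\<^sub>F \<epsilon> in at_right 0. \<epsilon> < \<bar>x $ i\<bar>"
    by (auto simp: supp_def eventually_at_right_less intro!: eventually_at_rightI[of 0 "\<bar>x $ _\<bar>"])
  then have "\<forall>\<^sub>F \<epsilon> in at_right 0. \<forall>i\<in>supp x. \<epsilon> < \<bar>x $ i\<bar>"
    by (simp add: eventually_ball_finite)
  moreover have "\<forall>\<^sub>F \<epsilon> in at_right 0. \<epsilon> < \<gamma> / (M + 1)"
    using pos \<open>M \<ge> 0\<close> by (intro eventually_at_rightI[of 0 "\<gamma> / (M + 1)"]) auto
  ultimately have "\<forall>\<^sub>F \<epsilon> in at_right 0. 0 < \<epsilon> \<and> (\<forall>i\<in>supp x. \<epsilon> < \<bar>x $ i\<bar>) \<and> \<epsilon> < \<gamma> / (M + 1)"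
    by (auto intro: eventually_conj eventually_at_right_less)
  then obtain \<delta> where \<delta>: "\<delta> > 0" "\<And>i. i \<in> supp x \<Longrightarrow> \<delta> < \<bar>x $ i\<bar>" "\<delta> < \<gamma> / (M + 1)"
    using eventually_happens'[OF trivial_limit_at_right_real] by blast
  have "l0_objective A a \<beta> \<gamma> x y \<le> l0_objective A a \<beta> \<gamma> (x + u) (y + v)" if u: "norm u \<le> \<delta>" for u v
  proof -
    have ge: "smooth_part A a \<beta> \<gamma> (x + u) (y + v)
        \<ge> smooth_part A a \<beta> \<gamma> x y + \<gamma> / \<beta> * inner (x - y) u"
      using smooth_part_ge[OF A pos st, of u v] pos by (smt (verit) divide_nonneg_pos mult_nonneg_nonneg zero_le_power2)
    have sub: "supp x \<subseteq> supp (x + u)"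
    proof
      fix i assume "i \<in> supp x"
      then have "\<bar>u $ i\<bar> < \<bar>x $ i\<bar>"
        using \<delta>(2)[of i] u component_le_norm_cart[of u i] by linarith
      then show "i \<in> supp (x + u)" by (auto simp: supp_def)
    qed
    show ?thesis
    proof (cases "supp (x + u) = supp x")
      case True
      \<comment> \<open>\<open>x - y\<close> lives off \<open>supp x\<close> and \<open>u\<close>
        lives on it, so the linear term vanishes.\<close>
      have "x - y = restrict_to (supp x) y - y"
        using x by simp
      moreover have "restrict_to (supp x) u = u"
      proof -
        have "u $ i = 0" if "x $ i = 0" for i
        proof -
          have "i \<notin> supp (x + u)" using True that by (simp add: supp_def)
          then show ?thesis using that by (simp add: supp_def)
        qed
        then show ?thesis by (simp add: vec_eq_iff supp_def)
      qed
      ultimately have "inner (x - y) u = 0"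
        by (metis eq_iff_diff_eq_0 inner_diff_left inner_restrict_to)
      then show ?thesis
        using ge True by (simp add: l0_objective_def l0_norm_def)
    next
      case False
      then have "card (supp x) + 1 \<le> card (supp (x + u))"
        using sub by (metis Suc_eq_plus1 Suc_leI finite psubsetI psubset_card_mono)
      then have "\<gamma> * (real (card (supp x)) + 1) \<le> \<gamma> * real (card (supp (x + u)))"
        using pos by (intro mult_left_mono) auto
      \<comment> \<open>The linear loss is at most the price \<open>\<gamma>\<close> of one new
        nonzero entry.\<close>
      moreover have "\<bar>\<gamma> / \<beta> * inner (x - y) u\<bar> \<le> \<gamma>"
      proof -
        have "\<bar>\<gamma> / \<beta> * inner (x - y) u\<bar> \<le> \<gamma> / \<beta> * (norm (x - y) * norm u)"
          using pos by (simp add: abs_mult Cauchy_Schwarz_ineq2 divide_right_mono)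
        also have "\<dots> = M * norm u" by (simp add: M_def)
        also have "\<dots> \<le> (M + 1) * \<delta>"
          using u \<open>M \<ge> 0\<close> by (intro mult_mono) auto
        also have "\<dots> \<le> \<gamma>"
          using \<delta>(3) \<open>M \<ge> 0\<close> by (simp add: field_simps)
        finally show ?thesis .
      qed
      ultimately show ?thesis
        using ge by (simp add: l0_objective_def l0_norm_def algebra_simps)
    qed
  qed
  then show ?thesis
    unfolding local_minimizer2_def using \<delta>(1) by blast
qed

text \<open>With \<open>P = restrict_to S\<close>, strictness at the threshold gives Q(y+v) =
  F(P(y+v), y+v) for small \<open>v\<close>. This is at least F(P y, y), which is at least
  Q(y).\<close>

lemma local_minimizer_envelope:
  assumes pos: "\<beta> > 0" "\<gamma> > 0"
    and lm: "local_minimizer2 (l0_objective A a \<beta> \<gamma>) (restrict_to S y) y"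
    and gt: "\<And>i. i \<in> S \<Longrightarrow> sqrt (2 * \<beta>) < \<bar>y $ i\<bar>"
    and lt: "\<And>i. i \<notin> S \<Longrightarrow> \<bar>y $ i\<bar> < sqrt (2 * \<beta>)"
  shows "local_minimizer (\<lambda>y. 1 / 2 * (norm (A y - a))\<^sup>2 + \<gamma> * env_l0 \<beta> y) y"
proof -
  obtain \<delta>0 where \<delta>0: "\<delta>0 > 0"
    "\<And>u v. norm u \<le> \<delta>0 \<Longrightarrow> norm v \<le> \<delta>0 \<Longrightarrow>
       l0_objective A a \<beta> \<gamma> (restrict_to S y) y \<le> l0_objective A a \<beta> \<gamma> (restrict_to S y + u) (y + v)"
    using lm unfolding local_minimizer2_def by blast
  \<comment> \<open>\<open>g i\<close> is the distance of an entry to the threshold; half the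
    minimum keeps \<open>\<delta>\<close> strictly below it, so no entry crosses.\<close>
  define g where "g i = \<bar>\<bar>y $ i\<bar> - sqrt (2 * \<beta>)\<bar>" for i
  define \<delta> where "\<delta> = min \<delta>0 (Min (range g) / 2)"
  have "g i > 0" for i
    using gt[of i] lt[of i] by (cases "i \<in> S") (auto simp: g_def)
  then have "Min (range g) > 0" by simp
  have "\<delta> > 0" using \<delta>0(1) \<open>Min (range g) > 0\<close> by (simp add: \<delta>_def)
  have \<delta>g: "\<delta> < g i" for i
  proof -
    have "Min (range g) \<le> g i" by simp
    then show ?thesis using \<open>Min (range g) > 0\<close> unfolding \<delta>_def by linarith
  qed
  have "1 / 2 * (norm (A y - a))\<^sup>2 + \<gamma> * env_l0 \<beta> y
      \<le> 1 / 2 * (norm (A (y + v) - a))\<^sup>2 + \<gamma> * env_l0 \<beta> (y + v)" if v: "norm v \<le> \<delta>" for v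
  proof -
    obtain z where z: "z \<in> prox_l0 \<beta> (y + v)" "env_l0 \<beta> (y + v) = prox_objective \<beta> (y + v) z"
      using env_l0_eq_prox[OF pos(1)] .
    obtain z' where z': "z' \<in> prox_l0 \<beta> y" "env_l0 \<beta> y = prox_objective \<beta> y z'"
      using env_l0_eq_prox[OF pos(1)] .
    have "i \<in> supp z \<longleftrightarrow> i \<in> S" for i
    proof -
      have "\<bar>v $ i\<bar> < g i"
        using \<delta>g[of i] v component_le_norm_cart[of v i] by linarith
      then have "if i \<in> S then sqrt (2 * \<beta>) < \<bar>(y + v) $ i\<bar> else \<bar>(y + v) $ i\<bar> < sqrt (2 * \<beta>)"
        using gt[of i] lt[of i] unfolding g_def vector_add_component by (smt (verit))
      then show ?thesis
        using prox_l0_nth[OF pos(1) z(1), of i] unfolding supp_def mem_Collect_eq by (smt (verit))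
    qed
    then have "supp z = S" by blast
    then have "z = restrict_to S y + restrict_to S v"
      using prox_l0_eq_restrict_to[OF pos(1) z(1)] by (simp add: linear_add[OF linear_restrict_to])
    then have "l0_objective A a \<beta> \<gamma> (restrict_to S y) y \<le> l0_objective A a \<beta> \<gamma> z (y + v)"
      using \<delta>0(2)[of "restrict_to S v" v] v norm_restrict_to_le[of S v] by (simp add: \<delta>_def)
    moreover have "prox_objective \<beta> y z' \<le> prox_objective \<beta> y (restrict_to S y)"
      using z'(1) by (simp add: prox_l0_def)
    then have "\<gamma> * prox_objective \<beta> y z' \<le> \<gamma> * prox_objective \<beta> y (restrict_to S y)"
      using pos by simp
    ultimately show ?thesis
      unfolding z(2) z'(2) l0_objective_prox[OF pos(2)] by linarith
  qed
  then show ?thesis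
    unfolding local_minimizer_def using \<open>\<delta> > 0\<close> by blast
qed

lemma increments_tendsto_0:
  assumes A: "linear A" and pos: "\<beta> > 0" "\<gamma> > 0"
    and prox: "\<And>k. x (Suc k) \<in> prox_l0 \<beta> (y k)"
    and st: "\<And>k. stationary A a (\<beta> / \<gamma>) (x (Suc k)) (y (Suc k))"
  shows "(\<lambda>k. y (Suc k) - y k) \<longlonglongrightarrow> 0"
proof -
  define F where "F k = l0_objective A a \<beta> \<gamma> (x k) (y k)" for k
  define D where "D k = \<gamma> / (2 * \<beta>) * (norm (y (Suc k) - y k))\<^sup>2" for k
  have D0: "D k \<ge> 0" for k using pos by (simp add: D_def)
  \<comment> \<open>The old \<open>y k\<close> is compared with the minimizer
    \<open>y (Suc k)\<close> at the same \<open>x (Suc k)\<close>, which yields \<open>D k\<close>;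
    the prox step then bounds the intermediate value by \<open>F k\<close>.\<close>
  have dec: "F (Suc k) + D k \<le> F k" for k
  proof -
    have "F (Suc k) + D k \<le> l0_objective A a \<beta> \<gamma> (x (Suc k)) (y k)"
      using smooth_part_ge[OF A pos st[of k], of 0 "y k - y (Suc k)"]
      by (simp add: F_def D_def l0_objective_def norm_minus_commute)
    also have "\<dots> \<le> F k"
      using prox[of k] pos by (simp add: F_def l0_objective_prox prox_l0_def)
    finally show ?thesis .
  qed
  have "decseq F"
    by (rule decseq_SucI) (use dec D0 in \<open>smt (verit)\<close>)
  moreover have "F k \<ge> 0" for k
    using pos by (simp add: F_def l0_objective_def smooth_part_def)
  ultimately obtain l where l: "F \<longlonglongrightarrow> l"
    using decseq_convergent[of F 0] by blast
  have "(\<lambda>k. F k - F (Suc k)) \<longlonglongrightarrow> l - l"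
    by (intro tendsto_diff l LIMSEQ_Suc)
  then have "(\<lambda>k. F k - F (Suc k)) \<longlonglongrightarrow> 0" by simp
  moreover have "D k \<le> F k - F (Suc k)" for k
    using dec[of k] by linarith
  ultimately have "D \<longlonglongrightarrow> 0"
    by (intro tendsto_sandwich[of "\<lambda>_. 0" D sequentially "\<lambda>k. F k - F (Suc k)"])
      (simp_all add: D0)
  then have "(\<lambda>k. sqrt (2 * \<beta> / \<gamma> * D k)) \<longlonglongrightarrow> sqrt (2 * \<beta> / \<gamma> * 0)"
    by (intro tendsto_intros)
  then have "(\<lambda>k. norm (y (Suc k) - y k)) \<longlonglongrightarrow> 0"
    using pos by (simp add: D_def)
  then show ?thesis
    by (rule tendsto_norm_zero_cancel)
qed

text \<open>Stationarity makes \<open>x\<close> an affine image of \<open>y\<close> at the same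
  index, so the increments of \<open>x\<close> vanish too; eventually they are too small for an
  entry to jump across the prox gap.\<close>

lemma supp_eventually_const:
  fixes A :: "real ^ 'n \<Rightarrow> 'b::euclidean_space"
  assumes A: "linear A" and pos: "\<beta> > 0" "\<gamma> > 0"
    and prox: "\<And>k. x (Suc k) \<in> prox_l0 \<beta> (y k)"
    and st: "\<And>k. stationary A a (\<beta> / \<gamma>) (x (Suc k)) (y (Suc k))"
  obtains n S where "\<And>k. k \<ge> n \<Longrightarrow> supp (x (Suc k)) = S"
proof -
  define c where "c = \<beta> / \<gamma>"
  define L where "L v = v + c *\<^sub>R adjoint A (A v)" for v
  have "linear L"
    unfolding L_def
    by (intro linear_compose_add linear_ident linear_compose_scale_right
        linear_compose[OF A adjoint_linear[OF A], unfolded o_def])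
  have x: "x (Suc k) = L (y (Suc k)) - c *\<^sub>R adjoint A a" for k
  proof -
    have "inner (y (Suc k) - x (Suc k) + c *\<^sub>R adjoint A (A (y (Suc k)) - a)) v = 0" for v
      using st[of k]
      by (simp add: stationary_def c_def inner_add_left adjoint_clauses[OF A])
    then have "y (Suc k) - x (Suc k) + c *\<^sub>R adjoint A (A (y (Suc k)) - a) = 0"
      using inner_eq_zero_iff by blast
    then show ?thesis
      by (simp add: L_def linear_diff[OF adjoint_linear[OF A]] algebra_simps)
  qed
  have "bounded_linear L"
    using \<open>linear L\<close> by (rule linear_conv_bounded_linear[THEN iffD1])
  then have "(\<lambda>k. L (y (Suc k) - y k)) \<longlonglongrightarrow> L 0"
    using increments_tendsto_0[where x = x and y = y, OF A pos prox st]
    by (rule bounded_linear.tendsto)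
  \<comment> \<open>The affine relation holds only from index 1 on, since the initial pair is
    arbitrary.\<close>
  then have "(\<lambda>k. L (y (Suc (Suc k)) - y (Suc k))) \<longlonglongrightarrow> 0"
    unfolding linear_0[OF \<open>linear L\<close>] by (rule LIMSEQ_Suc)
  moreover have "L (y (Suc (Suc k)) - y (Suc k)) = x (Suc (Suc k)) - x (Suc k)" for k
    by (simp add: x linear_diff[OF \<open>linear L\<close>])
  ultimately have "(\<lambda>k. x (Suc (Suc k)) - x (Suc k)) \<longlonglongrightarrow> 0" by simp
  then have "\<forall>\<^sub>F k in sequentially. norm (x (Suc (Suc k)) - x (Suc k)) < sqrt (2 * \<beta>)"
    using pos by (auto simp: tendsto_iff dist_norm)
  then obtain n where n: "\<And>k. k \<ge> n \<Longrightarrow> norm (x (Suc (Suc k)) - x (Suc k)) < sqrt (2 * \<beta>)"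
    by (auto simp: eventually_sequentially)
  have eq: "supp (x (Suc (Suc k))) = supp (x (Suc k))" if "k \<ge> n" for k
  proof -
    have "i \<in> supp (x (Suc (Suc k))) \<longleftrightarrow> i \<in> supp (x (Suc k))" for i
      using n[OF that] component_le_norm_cart[of "x (Suc (Suc k)) - x (Suc k)" i]
        prox_l0_nth_ge[OF pos(1) prox[of k], of i] prox_l0_nth_ge[OF pos(1) prox[of "Suc k"], of i]
      unfolding supp_def mem_Collect_eq vector_minus_component by (smt (verit))
    then show ?thesis by blast
  qed
  have "supp (x (Suc k)) = supp (x (Suc n))" if "k \<ge> n" for k
    using that by (induction rule: dec_induct) (auto simp: eq)
  then show thesis by (rule that)
qed

theorem alternating_l0_converges:
  fixes A :: "real ^ 'n \<Rightarrow> 'b::euclidean_space"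
  assumes A: "linear A" and pos: "\<beta> > 0" "\<gamma> > 0"
    and prox: "\<And>k. x (Suc k) \<in> prox_l0 \<beta> (y k)"
    and st: "\<And>k. stationary A a (\<beta> / \<gamma>) (x (Suc k)) (y (Suc k))"
  shows "\<exists>xs ys. (\<lambda>k. (x k, y k)) \<longlonglongrightarrow> (xs, ys)
    \<and> local_minimizer2 (l0_objective A a \<beta> \<gamma>) xs ys
    \<and> (\<lambda>k. l0_objective A a \<beta> \<gamma> (x k) (y k)) \<longlonglongrightarrow> l0_objective A a \<beta> \<gamma> xs ys
    \<and> ((\<forall>j \<in> supp ys. \<bar>ys $ j\<bar> \<noteq> sqrt (2 * \<beta>)) \<longrightarrow>
         local_minimizer (\<lambda>y. 1 / 2 * (norm (A y - a))\<^sup>2 + \<gamma> * env_l0 \<beta> y) ys)"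
proof -
  obtain n S where S: "\<And>k. k \<ge> n \<Longrightarrow> supp (x (Suc k)) = S"
    using supp_eventually_const[where x = x and y = y, OF A pos prox st] by blast
  \<comment> \<open>With the support frozen, thresholding is a fixed projection, so the scheme
    shifted by \<open>n\<close> is the projected iteration.\<close>
  have x: "x (Suc k) = restrict_to S (y k)" if "k \<ge> n" for k
    using prox_l0_eq_restrict_to[OF pos(1) prox] S[OF that] by metis
  have st': "stationary A a (\<beta> / \<gamma>) (restrict_to S (y (k + n))) (y (Suc k + n))" for k
    using st[of "k + n"] x[of "k + n"] by simp
  have diff: "(\<lambda>k. y (Suc k + n) - y (k + n)) \<longlonglongrightarrow> 0"
    using LIMSEQ_ignore_initial_segment[OF increments_tendsto_0[where x = x and y = y, OF A pos prox st], of n] by simp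
  obtain ys where "(\<lambda>k. y (k + n)) \<longlonglongrightarrow> ys" and stat: "stationary A a (\<beta> / \<gamma>) (restrict_to S ys) ys"
    by (rule projected_iteration_converges[OF A linear_restrict_to[of S], of "\<beta> / \<gamma>" a "\<lambda>k. y (k + n)"])
      (use pos st' diff in \<open>simp_all add: norm_restrict_to_le restrict_to_idem inner_restrict_to\<close>)
  then have ylim: "y \<longlonglongrightarrow> ys"
    by (simp add: LIMSEQ_offset)
  define xs where "xs = restrict_to S ys"
  have "(\<lambda>k. restrict_to S (y k)) \<longlonglongrightarrow> xs"
    unfolding xs_def using linear_restrict_to[of S, unfolded linear_conv_bounded_linear] ylim
    by (rule bounded_linear.tendsto)
  then have "(\<lambda>k. x (Suc k)) \<longlonglongrightarrow> xs"
    by (rule Lim_transform_eventually) (auto simp: eventually_sequentially x intro!: exI[of _ n])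
  then have xlim: "x \<longlonglongrightarrow> xs"
    by (simp add: filterlim_sequentially_Suc)
  have yabs: "(\<lambda>k. \<bar>y k $ i\<bar>) \<longlonglongrightarrow> \<bar>ys $ i\<bar>" for i
    using ylim by (intro tendsto_intros)
  have ge: "sqrt (2 * \<beta>) \<le> \<bar>ys $ i\<bar>" if "i \<in> S" for i
  proof (rule LIMSEQ_le_const[OF yabs], intro exI[of _ n] allI impI)
    fix k assume "n \<le> k"
    then have "x (Suc k) $ i \<noteq> 0" using S[of k] that by (auto simp: supp_def)
    then show "sqrt (2 * \<beta>) \<le> \<bar>y k $ i\<bar>"
      using prox_l0_nth[OF pos(1) prox[of k], of i] by simp
  qed
  have le: "\<bar>ys $ i\<bar> \<le> sqrt (2 * \<beta>)" if "i \<notin> S" for i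
  proof (rule LIMSEQ_le_const2[OF yabs], intro exI[of _ n] allI impI)
    fix k assume "n \<le> k"
    then have "x (Suc k) $ i = 0" using S[of k] that by (auto simp: supp_def)
    then show "\<bar>y k $ i\<bar> \<le> sqrt (2 * \<beta>)"
      using prox_l0_nth[OF pos(1) prox[of k], of i] by simp
  qed
  \<comment> \<open>A positive threshold prevents entries in \<open>S\<close> from vanishing in the
    limit.\<close>
  have "0 < sqrt (2 * \<beta>)" using pos by simp
  then have suppxs: "supp xs = S"
    using ge by (force simp: supp_def xs_def)
  have lm: "local_minimizer2 (l0_objective A a \<beta> \<gamma>) xs ys"
    using stat suppxs by (intro local_minimizer2_l0_objective[OF A pos]) (simp_all add: xs_def)
  \<comment> \<open>The counting term is discontinuous, but from \<open>n\<close> on it equals its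
    value at \<open>xs\<close>, so only the smooth part has to converge.\<close>
  have "(\<lambda>k. smooth_part A a \<beta> \<gamma> (x (Suc k)) (y (Suc k)) + \<gamma> * real (l0_norm xs))
      \<longlonglongrightarrow> l0_objective A a \<beta> \<gamma> xs ys"
    unfolding l0_objective_def using xlim ylim
    by (intro tendsto_add tendsto_const tendsto_smooth_part[OF A]) (simp_all add: LIMSEQ_Suc)
  then have "(\<lambda>k. l0_objective A a \<beta> \<gamma> (x (Suc k)) (y (Suc k))) \<longlonglongrightarrow> l0_objective A a \<beta> \<gamma> xs ys"
    by (rule Lim_transform_eventually)
      (auto simp: eventually_sequentially l0_objective_def l0_norm_def suppxs S intro!: exI[of _ n])
  then have Flim: "(\<lambda>k. l0_objective A a \<beta> \<gamma> (x k) (y k)) \<longlonglongrightarrow> l0_objective A a \<beta> \<gamma> xs ys"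
    by (rule LIMSEQ_imp_Suc)
  have "local_minimizer (\<lambda>y. 1 / 2 * (norm (A y - a))\<^sup>2 + \<gamma> * env_l0 \<beta> y) ys"
    if ne: "\<forall>j \<in> supp ys. \<bar>ys $ j\<bar> \<noteq> sqrt (2 * \<beta>)"
  proof -
    \<comment> \<open>Off the support the entry is zero and so differs from the positive threshold;
      all weak bounds become strict.\<close>
    have "\<bar>ys $ j\<bar> \<noteq> sqrt (2 * \<beta>)" for j
      using ne pos by (cases "j \<in> supp ys") (auto simp: supp_def)
    then have "\<And>i. i \<in> S \<Longrightarrow> sqrt (2 * \<beta>) < \<bar>ys $ i\<bar>"
      and "\<And>i. i \<notin> S \<Longrightarrow> \<bar>ys $ i\<bar> < sqrt (2 * \<beta>)"
      using ge le by (metis order_le_less)+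
    then show ?thesis
      by (rule local_minimizer_envelope[OF pos lm[unfolded xs_def]])
  qed
  then show ?thesis
    using tendsto_Pair[OF xlim ylim] lm Flim by blast
qed

section \<open>Real structure of complex matrices\<close>

lemma linear_complex_vec: "linear complex_vec"
  by (rule linearI) (simp_all add: complex_vec_def vec_eq_iff complex_eq_iff)

lemma inner_complex_vec: "inner (complex_vec u) (complex_vec v) = inner u v"
  by (simp add: inner_vec_def complex_vec_def inner_complex_def)

lemma linear_matrix_vector_mult_complex:
  fixes K :: "complex ^ 'n ^ 'd"
  shows "linear (\<lambda>v. K *v v)"
  by (rule linearI)
    (simp_all add: matrix_vector_mult_def vec_eq_iff distrib_left sum.distrib scaleR_sum_right)

text \<open>The real inner product is the real part of the Hermitian one, so the conjugate transpose
  is also the adjoint over the reals.\<close>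

lemma inner_conj_transpose:
  fixes K :: "complex ^ 'n ^ 'd"
  shows "inner (conj_transpose K *v w) v = inner w (K *v v)"
proof -
  have c: "inner z z' = Re (z * cnj z')" for z z' :: complex
    by (simp add: inner_complex_def)
  have "inner (conj_transpose K *v w) v
      = Re (\<Sum>i\<in>UNIV. \<Sum>j\<in>UNIV. cnj (K $ j $ i) * w $ j * cnj (v $ i))"
    by (simp add: inner_vec_def c conj_transpose_def matrix_vector_mult_def sum_distrib_right
        del: times_complex.sel)
  also have "\<dots> = Re (\<Sum>j\<in>UNIV. \<Sum>i\<in>UNIV. cnj (K $ j $ i) * w $ j * cnj (v $ i))"
    by (subst sum.swap) simp
  also have "\<dots> = inner w (K *v v)"
    by (simp add: inner_vec_def c matrix_vector_mult_def sum_distrib_left mult_ac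
        del: times_complex.sel)
  finally show ?thesis .
qed

theorem theorem6:
  fixes lbl :: "'m::finite \<Rightarrow> nat"
    and R :: "complex ^ 'm ^ 'd::finite"
    and W :: "real ^ 'm ^ 'n::finite"
    and K :: "complex ^ 'n ^ 'd"
    and r :: "real ^ 'd"
    and \<beta> \<gamma> :: real
    and x y :: "nat \<Rightarrow> real ^ 'n"
  assumes "CARD('d) < CARD('m)" and "CARD('m) \<le> CARD('n)"
    and "numbering lbl"
    and "row_selector lbl R"
    and "tight_framelet W"
    and "K = R ** fourier_matrix lbl ** conj_transpose (map_matrix complex_of_real W)"
    and "\<And>k. x (Suc k) \<in> prox_l0 \<beta> (y k)"
    and "\<And>k. complex_vec (y (Suc k)) = complex_vec (x (Suc k))
           - (\<beta> / \<gamma>) *\<^sub>R (conj_transpose K *v (K *v complex_vec (y (Suc k)) - complex_vec r))"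
    and "\<beta> > 0" and "\<gamma> > 0"
    and "0 < \<beta> / \<gamma>" and "\<beta> / \<gamma> < (sqrt 5 - 1) / 2"
  shows "\<exists>xs ys. (\<lambda>k. (x k, y k)) \<longlonglongrightarrow> (xs, ys)
    \<and> local_minimizer2 (objective_F K r \<beta> \<gamma>) xs ys
    \<and> (\<lambda>k. objective_F K r \<beta> \<gamma> (x k) (y k)) \<longlonglongrightarrow> objective_F K r \<beta> \<gamma> xs ys
    \<and> ((\<forall>j \<in> supp ys. \<bar>ys $ j\<bar> \<noteq> sqrt (2 * \<beta>)) \<longrightarrow>
         local_minimizer (objective_Q K r \<beta> \<gamma>) ys)"
proof -
  define A where "A v = K *v complex_vec v" for v :: "real ^ 'n"
  have A: "linear A"
    using linear_compose[OF linear_complex_vec linear_matrix_vector_mult_complex[of K]]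
    by (simp add: A_def[abs_def] o_def)
  have "stationary A (complex_vec r) (\<beta> / \<gamma>) (x (Suc k)) (y (Suc k))" for k
    unfolding stationary_def
  proof
    fix v
    let ?w = "A (y (Suc k)) - complex_vec r"
    \<comment> \<open>Testing the complex update against embedded real vectors gives the real
      first-order condition.\<close>
    have "complex_vec (y (Suc k) - x (Suc k)) = - ((\<beta> / \<gamma>) *\<^sub>R (conj_transpose K *v ?w))"
      unfolding linear_diff[OF linear_complex_vec] A_def by (subst assms(8)[of k]) simp
    then have "inner (complex_vec (y (Suc k) - x (Suc k))) (complex_vec v)
        = - ((\<beta> / \<gamma>) * inner ?w (A v))"
      by (simp add: inner_conj_transpose A_def)
    then show "inner (y (Suc k) - x (Suc k)) v + \<beta> / \<gamma> * inner ?w (A v) = 0"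
      by (simp add: inner_complex_vec)
  qed
  from alternating_l0_converges[where x = x and y = y, OF A assms(9,10,7) this]
  show ?thesis
    by (simp add: objective_F_def[abs_def] objective_Q_def[abs_def] l0_objective_def[abs_def]
        smooth_part_def A_def)
qed

end
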